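(* For $\mathcal{L}\in\{\mathsf{IEL}^-,\mathsf{IEL}\}$, the reflection scheme is not derivable: $\mathcal{L}\nvdash \mathbf{K}A\rightarrow A$, i.e. there is a formula $A$ such that $\mathbf{K}A\rightarrow A$ is not a theorem of $\mathcal{L}$.
   Context: Formulas are built from a countably infinite set of propositional letters and $\bot$ using $\land,\lor,\rightarrow$ and a unary operator $\mathbf{K}$; $\neg A$ abbreviates $A\rightarrow\bot$. The system $\mathsf{IEL}^-$ has as axioms all instances, in this language, of: the axioms of intuitionistic propositional logic; distribution $\mathbf{K}(A\rightarrow B)\rightarrow(\mathbf{K}A\rightarrow\mathbf{K}B)$; co-reflection $A\rightarrow\mathbf{K}A$. The only rule is Modus Ponens. $\mathsf{IEL}$ is $\mathsf{IEL}^-$ plus all instances of intuitionistic reflection $\mathbf{K}A\rightarrow\neg\neg A$. $\mathcal{L}\vdash A$ means $A$ is derivable in $\mathcal{L}$. *)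

theory Defs
  imports Main
begin

datatype fm =
    Atom nat
  | Falsum  (\<open>\<^bold>\<bottom>\<close>)
  | Conj fm fm  (infixr \<open>\<^bold>\<and>\<close> 75)
  | Disj fm fm  (infixr \<open>\<^bold>\<or>\<close> 70)
  | Impl fm fm  (infixr \<open>\<^bold>\<rightarrow>\<close> 65)
  | Know fm  (\<open>\<^bold>K _\<close> [80] 80)

abbreviation Neg :: "fm \<Rightarrow> fm"  (\<open>\<^bold>\<not> _\<close> [80] 80)
  where "\<^bold>\<not> A \<equiv> A \<^bold>\<rightarrow> \<^bold>\<bottom>"

text \<open>
  A standard Hilbert axiomatisation of intuitionistic propositional logic (complete with
  Modus Ponens as the only rule). The schematic letters range over all formulas, including
  those containing the epistemic operator.
\<close>

inductive int_axiom :: "fm \<Rightarrow> bool" where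
  "int_axiom (A \<^bold>\<rightarrow> (B \<^bold>\<rightarrow> A))"
| "int_axiom ((A \<^bold>\<rightarrow> (B \<^bold>\<rightarrow> C)) \<^bold>\<rightarrow> ((A \<^bold>\<rightarrow> B) \<^bold>\<rightarrow> (A \<^bold>\<rightarrow> C)))"
| "int_axiom ((A \<^bold>\<and> B) \<^bold>\<rightarrow> A)"
| "int_axiom ((A \<^bold>\<and> B) \<^bold>\<rightarrow> B)"
| "int_axiom (A \<^bold>\<rightarrow> (B \<^bold>\<rightarrow> (A \<^bold>\<and> B)))"
| "int_axiom (A \<^bold>\<rightarrow> (A \<^bold>\<or> B))"
| "int_axiom (B \<^bold>\<rightarrow> (A \<^bold>\<or> B))"
| "int_axiom ((A \<^bold>\<rightarrow> C) \<^bold>\<rightarrow> ((B \<^bold>\<rightarrow> C) \<^bold>\<rightarrow> ((A \<^bold>\<or> B) \<^bold>\<rightarrow> C)))"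
| "int_axiom (\<^bold>\<bottom> \<^bold>\<rightarrow> A)"

datatype system = IEL_minus | IEL

inductive iel_axiom :: "system \<Rightarrow> fm \<Rightarrow> bool" where
  intuitionistic: "int_axiom A \<Longrightarrow> iel_axiom L A"
| distribution: "iel_axiom L (\<^bold>K (A \<^bold>\<rightarrow> B) \<^bold>\<rightarrow> (\<^bold>K A \<^bold>\<rightarrow> \<^bold>K B))"
| co_reflection: "iel_axiom L (A \<^bold>\<rightarrow> \<^bold>K A)"
| int_reflection: "iel_axiom IEL (\<^bold>K A \<^bold>\<rightarrow> \<^bold>\<not> (\<^bold>\<not> A))"

inductive derivable :: "system \<Rightarrow> fm \<Rightarrow> bool"  (infix \<open>\<turnstile>\<close> 50) where
  axiom: "iel_axiom L A \<Longrightarrow> L \<turnstile> A"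
| modus_ponens: "L \<turnstile> (A \<^bold>\<rightarrow> B) \<Longrightarrow> L \<turnstile> A \<Longrightarrow> L \<turnstile> B"

end

theory Submission
  imports Defs
begin

text \<open>
  Double negation satisfies distribution, co-reflection and intuitionistic reflection, so
  every Heyting algebra is a model when \<open>\<^bold>K\<close> is read as double negation. In the
  three-element chain \<open>0 < 1 < 2\<close> the middle element is dense but not the top, which
  refutes reflection.
\<close>

text \<open>On values up to 2 this is the Heyting implication of the chain, the residual of
  \<open>min\<close>.\<close>

definition chain_imp :: "nat \<Rightarrow> nat \<Rightarrow> nat" where
  "chain_imp a b = (if a \<le> b then 2 else b)"

primrec chain_val :: "fm \<Rightarrow> nat" where
  "chain_val (Atom n) = 1"
| "chain_val \<^bold>\<bottom> = 0"
| "chain_val (A \<^bold>\<and> B) = min (chain_val A) (chain_val B)"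
| "chain_val (A \<^bold>\<or> B) = max (chain_val A) (chain_val B)"
| "chain_val (A \<^bold>\<rightarrow> B) = chain_imp (chain_val A) (chain_val B)"
| "chain_val (\<^bold>K A) = chain_imp (chain_imp (chain_val A) 0) 0"

text \<open>The type \<open>nat\<close> has no top element; this bound makes 2 the greatest value
  taken.\<close>

lemma chain_val_le: "chain_val A \<le> 2"
  by (induction A) (auto simp: chain_imp_def)

lemma chain_val_int_axiom: "int_axiom A \<Longrightarrow> chain_val A = 2"
  by (induction rule: int_axiom.induct)
    (use chain_val_le in \<open>auto simp: chain_imp_def min_def max_def intro: le_antisym\<close>)

lemma chain_val_iel_axiom: "iel_axiom L A \<Longrightarrow> chain_val A = 2"
  by (induction rule: iel_axiom.induct)
    (use chain_val_le in \<open>auto simp: chain_val_int_axiom chain_imp_def\<close>)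

lemma chain_val_derivable: "L \<turnstile> A \<Longrightarrow> chain_val A = 2"
proof (induction rule: derivable.induct)
  case (axiom L A)
  then show ?case by (rule chain_val_iel_axiom)
next
  case (modus_ponens L A B)
  then show ?case
    \<comment> \<open>With \<open>a = 2\<close>, \<open>chain_imp a b = 2\<close> yields
      \<open>2 \<le> b\<close>; the bound makes this an equality.\<close>
    using chain_val_le[of B] by (auto simp: chain_imp_def split: if_splits)
qed

theorem theorem5:
  fixes L :: system
  assumes "L \<in> {IEL_minus, IEL}"
  shows "\<exists>A :: fm. \<not> (L \<turnstile> (\<^bold>K A \<^bold>\<rightarrow> A))"
proof
  \<comment> \<open>The atom has value 1, its double negation 2, and \<open>chain_imp 2 1\<close> is
    1.\<close>
  have "chain_val (\<^bold>K (Atom 0) \<^bold>\<rightarrow> Atom 0) \<noteq> 2"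
    by (simp add: chain_imp_def)
  then show "\<not> (L \<turnstile> (\<^bold>K (Atom 0) \<^bold>\<rightarrow> Atom 0))"
    using chain_val_derivable by blast
qed

end
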